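(* Let $a,b,\sigma\ge 0$, let $\rho,\theta$ be probability measures on $(0,+\infty)$ with $\int_0^{+\infty}R\,\rho(\mathrm{d}R)<+\infty$, let $Q=(Q_t)_{t\in\mathbb{R}}$ be a stationary non-negative discharge process with mean $\bar Q>0$, variance $\bar V>0$ and autocorrelation $A_Q(h)=\int_0^{+\infty}e^{-rh}\,\theta(\mathrm{d}r)$ ($h\ge0$), and let $M=(M_t)_{t\in\mathbb{R}}$, $M_t=\int_0^{+\infty}m_t(\mathrm{d}R)$, be the memory process driven by $Q$ with parameters $a,b,\sigma,\rho$ (as defined in the context), in the stationary state. For $h\in\mathbb{R}$ let $$\lambda(h)=\mathbb{E}\bigl[(Q_t-\mathbb{E}[Q_t])(M_{t+h}-\mathbb{E}[M_t])\bigr]$$ be the mutual covariance with time lag $h$. Then $$\lambda(h)=\begin{cases}F(h)&(h\ge0)\\ G(-h)&(h<0),\end{cases}$$ where, for $l\ge0$, $$F(l)=b\bar V\int_{R=0}^{R=+\infty}\int_{r=0}^{r=+\infty}\left\{\frac{R}{R+r}e^{-Rl}+\frac{R}{R-r}\left(e^{-rl}-e^{-Rl}\right)\right\}\theta(\mathrm{d}r)\,\rho(\mathrm{d}R)$$ and $$G(l)=b\bar V\int_{R=0}^{R=+\infty}\int_{r=0}^{r=+\infty}\frac{R}{R+r}e^{-rl}\,\theta(\mathrm{d}r)\,\rho(\mathrm{d}R).$$ In particular, the covariance between $M$ and $Q$ is $$\mathbb{E}\bigl[(Q_t-\mathbb{E}[Q_t])(M_t-\mathbb{E}[M_t])\bigr]=\lambda(0)=b\bar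 V\int_{R=0}^{R=+\infty}\int_{r=0}^{r=+\infty}\frac{R}{R+r}\,\theta(\mathrm{d}r)\,\rho(\mathrm{d}R).$$
   Context: All processes live on a complete probability space with a filtration; $\mathbb{E}$ and $\mathbb{V}$ denote expectation and variance. Discharge: $Q=(Q_t)_{t\in\mathbb{R}}$ is a real-valued, non-negative, stationary, continuous-time process with $\bar Q=\mathbb{E}[Q_t]>0$, $\bar V=\mathbb{V}[Q_t]>0$, and $\mathbb{E}[(Q_s-\bar Q)(Q_t-\bar Q)]=\bar V A_Q(|s-t|)$, where $A_Q(h)=\int_0^{+\infty}e^{-rh}\theta(\mathrm{d}r)$ for $h\ge0$ and $\theta$ is a probability measure on $(0,+\infty)$. Memory process: let $a,b,\sigma\ge0$ and let $\rho$ be a probability measure on $(0,+\infty)$. The process $m=(m_t(\mathrm{d}R))_{t\in\mathbb{R}}$ is a stationary process with values in the non-negative measures on $(0,+\infty)$ solving $$\mathrm{d}m_t(\mathrm{d}R)=-R\bigl(m_t(\mathrm{d}R)-(a+bQ_t)\rho(\mathrm{d}R)\bigr)\mathrm{d}t+\sigma\sqrt{R}\,B(\mathrm{d}R,\mathrm{d}t),$$ understood in the integrated form $$m_t(\mathrm{d}R)=\int_{s=-\infty}^{s=t}e^{-R(t-s)}\left\{R(a+bQ_s)\rho(\mathrm{d}R)\,\mathrm{d}s+\sigma\sqrt{R}\,B(\mathrm{d}R,\mathrm{d}s)\right\},$$ and the memory process is the total mass $M_t=\int_0^{+\infty}m_t(\mathrm{d}R)$. Here $B$ is the space-time random measure (two-sided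 in time) formally given by $B(\mathrm{d}R,\mathrm{d}t)=\sqrt{m_t(\mathrm{d}R)}\,\zeta(\mathrm{d}R,\mathrm{d}t)$ with $\zeta$ a space-time Gaussian white noise independent of $Q$; formally $\mathbb{E}[B(\mathrm{d}R,\mathrm{d}t)B(\mathrm{d}R',\mathrm{d}t')]=\delta(R-R')\delta(t-t')\,\mathbb{E}\bigl[\sqrt{m_t(\mathrm{d}R)m_{t'}(\mathrm{d}R')}\bigr]\mathrm{d}t\,\mathrm{d}t'$. This means: for deterministic $f,g$ on $(0,+\infty)\times\mathbb{R}$ with $\mathbb{E}\bigl[\iint f^2\,m_s(\mathrm{d}R)\mathrm{d}s\bigr]<\infty$ and likewise for $g$, the stochastic integrals have mean zero, satisfy the isometry $$\mathbb{E}\Bigl[\iint f(R,s)B(\mathrm{d}R,\mathrm{d}s)\iint g(R,s)B(\mathrm{d}R,\mathrm{d}s)\Bigr]=\mathbb{E}\Bigl[\iint f(R,s)g(R,s)\,m_s(\mathrm{d}R)\,\mathrm{d}s\Bigr],$$ and are uncorrelated with every square-integrable random variable measurable with respect to $\sigma(Q_u:u\in\mathbb{R})$. Convention: in $F(l)$, when $R=r$ the quotient $\frac{e^{-rl}-e^{-Rl}}{R-r}$ is understood as its limit $l e^{-rl}$. *)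

theory Defs
  imports "HOL-Probability.Probability"
begin

definition pos_borel :: "real measure" where
  "pos_borel = restrict_space borel {0<..}"

text \<open>
  The measurable space of all non-negative measures on \<open>K\<close>, with the \<open>\<sigma>\<close>-algebra generated by
  the evaluations; the analogue of \<^const>\<open>subprob_algebra\<close> without a bound on the mass.
\<close>

definition measure_algebra :: "'b measure \<Rightarrow> 'b measure measure" where
  "measure_algebra K =
    (SUP A \<in> sets K. vimage_algebra {\<mu>. sets \<mu> = sets K} (\<lambda>\<mu>. emeasure \<mu> A) borel)"

definition stationary_process :: "'a measure \<Rightarrow> 'b measure \<Rightarrow> (real \<Rightarrow> 'a \<Rightarrow> 'b) \<Rightarrow> bool" where
  "stationary_process P N X \<longleftrightarrow>
    (\<forall>t. X t \<in> measurable P N) \<and>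
    (\<forall>J h. finite J \<longrightarrow>
      distr P (Pi\<^sub>M J (\<lambda>_. N)) (\<lambda>\<omega>. \<lambda>t\<in>J. X (t + h) \<omega>) =
      distr P (Pi\<^sub>M J (\<lambda>_. N)) (\<lambda>\<omega>. \<lambda>t\<in>J. X t \<omega>))"

definition covariance :: "'a measure \<Rightarrow> ('a \<Rightarrow> real) \<Rightarrow> ('a \<Rightarrow> real) \<Rightarrow> real" where
  "covariance P X Y =
    (\<integral>\<omega>. (X \<omega> - integral\<^sup>L P X) * (Y \<omega> - integral\<^sup>L P Y) \<partial>P)"

definition generated_algebra :: "'a measure \<Rightarrow> ('t \<Rightarrow> 'a \<Rightarrow> real) \<Rightarrow> 'a measure" where
  "generated_algebra P X =
    sigma (space P) {X t -` A \<inter> space P | t A. A \<in> sets borel}"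

definition autocorrelation :: "real measure \<Rightarrow> real \<Rightarrow> real" where
  "autocorrelation \<theta> h = (\<integral>r. exp (- r * h) \<partial>\<theta>)"

locale discharge_process =
  prob_space P + complete_measure P + filtration "space P" Filt
  for P :: "'a measure" and Filt :: "real \<Rightarrow> 'a measure" +
  fixes Q :: "real \<Rightarrow> 'a \<Rightarrow> real" and Qbar Vbar :: real and \<theta> :: "real measure"
  assumes Filt_subalgebra: "\<And>t. subalgebra P (Filt t)"
    and Q_adapted: "\<And>t. Q t \<in> borel_measurable (Filt t)"
    and Q_jointly_measurable: "case_prod Q \<in> borel_measurable (borel \<Otimes>\<^sub>M P)"
    and Q_nonneg: "\<And>t \<omega>. \<omega> \<in> space P \<Longrightarrow> 0 \<le> Q t \<omega>"
    and Q_stationary: "stationary_process P borel Q"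
    and Q_square_integrable: "\<And>t. integrable P (\<lambda>\<omega>. (Q t \<omega>)\<^sup>2)"
    and Qbar_pos: "0 < Qbar"
    and Vbar_pos: "0 < Vbar"
    and Q_mean: "\<And>t. expectation (Q t) = Qbar"
    and Q_variance: "\<And>t. variance (Q t) = Vbar"
    and \<theta>_prob: "prob_space \<theta>"
    and \<theta>_sets: "sets \<theta> = sets pos_borel"
    and Q_autocovariance:
      "\<And>s t. covariance P (Q s) (Q t) = Vbar * autocorrelation \<theta> \<bar>s - t\<bar>"

text \<open>
  Deterministic integrands \<open>f R s\<close> on \<open>(0,\<infinity>) \<times> \<real>\<close> for which the stochastic integral against the
  noise with intensity \<open>m\<^sub>s(dR) ds\<close> is defined.
\<close>

definition noise_integrable ::
    "'a measure \<Rightarrow> (real \<Rightarrow> 'a \<Rightarrow> real measure) \<Rightarrow> (real \<Rightarrow> real \<Rightarrow> real) \<Rightarrow> bool" where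
  "noise_integrable P m f \<longleftrightarrow>
    case_prod f \<in> borel_measurable (pos_borel \<Otimes>\<^sub>M borel) \<and>
    (\<integral>\<^sup>+\<omega>. \<integral>\<^sup>+s. \<integral>\<^sup>+R. ennreal ((f R s)\<^sup>2) \<partial>m s \<omega> \<partial>lborel \<partial>P) < \<infinity>"

text \<open>
  The random measure \<open>B\<close> enters through its stochastic integral: \<open>BI f\<close> is
  \<open>\<integral>\<integral> f(R,s) B(dR,ds)\<close>, so that \<open>B(C) = BI (1\<^sub>C)\<close>. Almost sure linearity of \<open>BI\<close> on
  integrands of finite energy is not assumed, being a consequence of the isometry.
\<close>

locale space_time_noise = discharge_process P Filt Q Qbar Vbar \<theta>
  for P :: "'a measure" and Filt and Q :: "real \<Rightarrow> 'a \<Rightarrow> real" and Qbar Vbar \<theta> +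
  fixes m :: "real \<Rightarrow> 'a \<Rightarrow> real measure"
    and BI :: "(real \<Rightarrow> real \<Rightarrow> real) \<Rightarrow> 'a \<Rightarrow> real"
  assumes m_adapted: "\<And>t. m t \<in> measurable (Filt t) (measure_algebra pos_borel)"
    and m_jointly_measurable:
      "case_prod m \<in> measurable (borel \<Otimes>\<^sub>M P) (measure_algebra pos_borel)"
    and BI_measurable:
      "\<And>f. noise_integrable P m f \<Longrightarrow> BI f \<in> borel_measurable P"
    and BI_square_integrable:
      "\<And>f. noise_integrable P m f \<Longrightarrow> integrable P (\<lambda>\<omega>. (BI f \<omega>)\<^sup>2)"
    and BI_mean_zero:
      "\<And>f. noise_integrable P m f \<Longrightarrow> expectation (BI f) = 0"
    and BI_isometry:
      "\<And>f g. noise_integrable P m f \<Longrightarrow> noise_integrable P m g \<Longrightarrow>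
        expectation (\<lambda>\<omega>. BI f \<omega> * BI g \<omega>) =
        expectation (\<lambda>\<omega>. \<integral>s. \<integral>R. f R s * g R s \<partial>m s \<omega> \<partial>lborel)"
    and BI_uncorrelated:
      "\<And>f Z. noise_integrable P m f \<Longrightarrow> Z \<in> borel_measurable (generated_algebra P Q) \<Longrightarrow>
        integrable P (\<lambda>\<omega>. (Z \<omega>)\<^sup>2) \<Longrightarrow> covariance P (BI f) Z = 0"

definition drift_part ::
    "real measure \<Rightarrow> real \<Rightarrow> real \<Rightarrow> (real \<Rightarrow> 'a \<Rightarrow> real) \<Rightarrow> real \<Rightarrow> real set \<Rightarrow> 'a \<Rightarrow> real" where
  "drift_part \<rho> a b Q t A \<omega> =
    set_lebesgue_integral (\<rho> \<Otimes>\<^sub>M lborel) (A \<times> {..t})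
      (\<lambda>(R, s). exp (- R * (t - s)) * (R * (a + b * Q s \<omega>)))"

definition noise_kernel :: "real \<Rightarrow> real \<Rightarrow> real set \<Rightarrow> real \<Rightarrow> real \<Rightarrow> real" where
  "noise_kernel \<sigma> t A R s =
    indicator (A \<times> {..t}) (R, s) * (exp (- R * (t - s)) * (\<sigma> * sqrt R))"

text \<open>
  The integrated equation is an identity of random measures: it is tested on every Borel set
  \<open>A\<close>, almost surely, since stochastic integrals are determined only up to null sets. Comparing
  in \<^typ>\<open>ereal\<close> makes both the finiteness of \<open>m\<^sub>t(A)\<close> and the sign of the right-hand side part
  of the equation.
\<close>

locale memory_process = space_time_noise P Filt Q Qbar Vbar \<theta> m BI
  for P :: "'a measure" and Filt and Q :: "real \<Rightarrow> 'a \<Rightarrow> real" and Qbar Vbar \<theta> m BI +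
  fixes a b \<sigma> :: real and \<rho> :: "real measure"
  assumes a_nonneg: "0 \<le> a" and b_nonneg: "0 \<le> b" and \<sigma>_nonneg: "0 \<le> \<sigma>"
    and \<rho>_prob: "prob_space \<rho>"
    and \<rho>_sets: "sets \<rho> = sets pos_borel"
    and m_stationary: "stationary_process P (measure_algebra pos_borel) m"
    and noise_kernel_integrable:
      "\<And>t A. A \<in> sets pos_borel \<Longrightarrow> noise_integrable P m (noise_kernel \<sigma> t A)"
    and integrated_equation:
      "\<And>t A. A \<in> sets pos_borel \<Longrightarrow>
        (AE \<omega> in P. enn2ereal (emeasure (m t \<omega>) A) =
          ereal (drift_part \<rho> a b Q t A \<omega> + BI (noise_kernel \<sigma> t A) \<omega>))"

definition total_memory :: "(real \<Rightarrow> 'a \<Rightarrow> real measure) \<Rightarrow> real \<Rightarrow> 'a \<Rightarrow> real" where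
  "total_memory m t \<omega> = measure (m t \<omega>) {0<..}"

text \<open>The time \<open>t\<close> is kept as an argument; that the value does not depend on it is part of the claim.\<close>

definition mutual_covariance ::
    "'a measure \<Rightarrow> (real \<Rightarrow> 'a \<Rightarrow> real) \<Rightarrow> (real \<Rightarrow> 'a \<Rightarrow> real) \<Rightarrow> real \<Rightarrow> real \<Rightarrow> real" where
  "mutual_covariance P X Y t h = covariance P (X t) (Y (t + h))"

text \<open>On the diagonal \<open>R = r\<close> the quotient is replaced by its limit.\<close>

definition exp_quotient :: "real \<Rightarrow> real \<Rightarrow> real \<Rightarrow> real" where
  "exp_quotient l R r =
    (if R = r then l * exp (- r * l) else (exp (- r * l) - exp (- R * l)) / (R - r))"

definition F_cov :: "real \<Rightarrow> real \<Rightarrow> real measure \<Rightarrow> real measure \<Rightarrow> real \<Rightarrow> real" where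
  "F_cov b Vbar \<rho> \<theta> l =
    b * Vbar * (\<integral>R. (\<integral>r. R / (R + r) * exp (- R * l) + R * exp_quotient l R r \<partial>\<theta>) \<partial>\<rho>)"

definition G_cov :: "real \<Rightarrow> real \<Rightarrow> real measure \<Rightarrow> real measure \<Rightarrow> real \<Rightarrow> real" where
  "G_cov b Vbar \<rho> \<theta> l =
    b * Vbar * (\<integral>R. (\<integral>r. R / (R + r) * exp (- r * l) \<partial>\<theta>) \<partial>\<rho>)"

end

theory Submission
  imports Defs
begin

text \<open>
  Fix a lag and put \<open>u = t + h\<close>. Tested on the whole half-line \<open>{0<..}\<close>, the integrated equation
  writes \<open>M\<^sub>u\<close> almost surely as a drift plus a stochastic integral with a deterministic integrand.
  The stochastic integral is uncorrelated with \<open>Q\<^sub>t\<close>, so only the drift contributes to the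
  covariance.

  The drift is a weighted average of the forcing \<open>a + b Q\<^sub>s\<close>. Its weight
  \<open>R e\<^bsup>-R(u-s)\<^esup>\<close> on \<open>s \<le> u\<close> is, for each \<open>R\<close>, the density of \<open>u\<close> minus an exponential
  variable of rate \<open>R\<close>, so with respect to \<open>\<rho>(dR) ds\<close> the total weight is one. The second moment
  of \<open>Q\<^sub>s\<close> does not depend on \<open>s\<close>, so Fubini's theorem moves the expectation inside the average
  (\<open>weighted_average\<close>, \<open>drift_part_moments\<close>), and the covariance becomes \<open>b Vbar\<close> times the weighted
  average of the autocorrelation of \<open>Q\<close> at lag \<open>\<bar>t - s\<bar>\<close>.

  Writing the autocorrelation as a \<open>\<theta>\<close>-mixture of exponentials and using Fubini's theorem once more
  (\<open>weighted_autocorrelation\<close>) leaves, for fixed rates \<open>R\<close> and \<open>r\<close>, the elementary integral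
  of \<open>R e\<^bsup>-R(u-s)\<^esup> e\<^bsup>-r\<bar>t-s\<bar>\<^esup>\<close> over \<open>s \<le> u\<close> (\<open>lag_integral\<close>). For \<open>u < t\<close> the
  absolute value has constant sign and the integrand of \<open>G\<close> results; for \<open>t \<le> u\<close> the part
  \<open>s \<le> t\<close> gives the first summand in the integrand of \<open>F\<close>, and the part \<open>t \<le> s \<le> u\<close> the second.
\<close>

section \<open>Elementary exponential integrals\<close>

text \<open>
  Up to the factor \<open>c\<close>, this is the total mass of an exponential distribution of rate \<open>c\<close> after the
  substitution \<open>x = v - s\<close>.
\<close>

lemma has_bochner_integral_exp_half_line:
  fixes v c :: real
  assumes "0 < c"
  shows "has_bochner_integral lborel (\<lambda>s. indicator {..v} s * exp (- c * (v - s))) (1 / c)"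
proof -
  interpret prob_space "density lborel (exponential_density c)"
    using assms by (rule prob_space_exponential_density)
  have "(\<integral>\<^sup>+x. ennreal (exponential_density c x) \<partial>lborel) = ennreal 1"
    using emeasure_space_1 by (simp add: emeasure_density)
  then have "has_bochner_integral lborel (exponential_density c) 1"
    using exponential_density_nonneg[OF assms]
    by (intro has_bochner_integral_nn_integral) auto
  then have "has_bochner_integral lborel (\<lambda>s. exponential_density c (v + (-1) * s)) (1 /\<^sub>R \<bar>-1\<bar>)"
    by (subst (asm) lborel_has_bochner_integral_real_affine_iff[where c="-1" and t=v]) auto
  then have "has_bochner_integral lborel (\<lambda>s. exponential_density c (v + (-1) * s) * (1 / c)) (1 / c)"
    using has_bochner_integral_mult_left[of "1 / c" lborel _ 1] by simp
  moreover have "exponential_density c (v + (-1) * s) * (1 / c) = indicator {..v} s * exp (- c * (v - s))" for s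
    using assms by (auto simp: exponential_density_def indicator_def algebra_simps)
  ultimately show ?thesis by simp
qed

text \<open>
  The correlation at rate \<open>r\<close> between time \<open>t\<close> and a random time \<open>s\<close> that lies an exponential
  delay of rate \<open>R\<close> before \<open>u\<close>. The kink of \<open>\<bar>t - s\<bar>\<close> at \<open>s = t\<close> falls into the range of integration
  exactly when \<open>t \<le> u\<close>; this is where the two regimes of the mutual covariance come from.
\<close>

lemma lag_integral:
  fixes t u R r :: real
  assumes "0 < R" "0 < r"
  shows "has_bochner_integral lborel (\<lambda>s. indicator {..u} s * (R * exp (- R * (u - s))) * exp (- r * \<bar>t - s\<bar>))
    (if t \<le> u then R / (R + r) * exp (- R * (u - t)) + R * exp_quotient (u - t) R r
     else R / (R + r) * exp (- r * (t - u)))"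
proof (cases "t \<le> u")
  case False
  have "has_bochner_integral lborel (\<lambda>s. (R * exp (- r * (t - u))) * (indicator {..u} s * exp (- (R + r) * (u - s))))
     ((R * exp (- r * (t - u))) * (1 / (R + r)))"
    using assms by (intro has_bochner_integral_mult_right has_bochner_integral_exp_half_line) auto
  moreover have eq: "(R * exp (- r * (t - u))) * (indicator {..u} s * exp (- (R + r) * (u - s))) =
     indicator {..u} s * (R * exp (- R * (u - s))) * exp (- r * \<bar>t - s\<bar>)" for s
    using False by (auto simp: indicator_def exp_add[symmetric] algebra_simps)
  ultimately show ?thesis using False unfolding eq by (simp add: mult.commute)
next
  case True
  have past: "has_bochner_integral lborel (\<lambda>s. (R * exp (- R * (u - t))) * (indicator {..t} s * exp (- (R + r) * (t - s))))
     ((R * exp (- R * (u - t))) * (1 / (R + r)))"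
    using assms by (intro has_bochner_integral_mult_right has_bochner_integral_exp_half_line) auto
  have "has_bochner_integral lborel (\<lambda>s. exp (- R * (u - s)) * exp (- r * (s - t)) * indicator {t..u} s)
     (exp_quotient (u - t) R r)"
  proof (cases "R = r")
    case True
    \<comment> \<open>For equal rates the two exponentials compensate and the integrand is constant.\<close>
    have "has_bochner_integral lborel (\<lambda>s. exp (- r * (u - t)) * indicator {t..u} s)
        (exp (- r * (u - t)) * u - exp (- r * (u - t)) * t)"
      using \<open>t \<le> u\<close> by (intro has_bochner_integral_FTC_Icc_real) (auto intro!: derivative_eq_intros)
    moreover have "exp (- R * (u - s)) * exp (- r * (s - t)) = exp (- r * (u - t))" for s
      using True by (auto simp: exp_add[symmetric] algebra_simps)
    ultimately show ?thesis using True by (simp add: exp_quotient_def algebra_simps)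
  next
    case False
    have "has_bochner_integral lborel (\<lambda>s. exp (- R * (u - s) - r * (s - t)) * indicator {t..u} s)
        (exp (- R * (u - u) - r * (u - t)) / (R - r) - exp (- R * (u - t) - r * (t - t)) / (R - r))"
    proof (rule has_bochner_integral_FTC_Icc_real[OF \<open>t \<le> u\<close>])
      fix s
      have "((\<lambda>s. exp (- R * (u - s) - r * (s - t)) / (R - r)) has_real_derivative
          exp (- R * (u - s) - r * (s - t)) * (R - r) / (R - r)) (at s)"
        by (intro DERIV_cdivide) (auto intro!: derivative_eq_intros)
      then show "((\<lambda>s. exp (- R * (u - s) - r * (s - t)) / (R - r)) has_real_derivative
          exp (- R * (u - s) - r * (s - t))) (at s)"
        using False by simp
    qed auto
    moreover have "exp (- R * (u - s) - r * (s - t)) = exp (- R * (u - s)) * exp (- r * (s - t))" for s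
      by (simp add: exp_add[symmetric])
    ultimately show ?thesis using False by (simp add: exp_quotient_def diff_divide_distrib)
  qed
  then have "has_bochner_integral lborel (\<lambda>s. R * (exp (- R * (u - s)) * exp (- r * (s - t)) * indicator {t..u} s))
     (R * exp_quotient (u - t) R r)"
    by (intro has_bochner_integral_mult_right) auto
  note has_bochner_integral_add[OF past this]
  \<comment> \<open>The two pieces overlap in the single point \<open>t\<close>, which is a null set.\<close>
  moreover have "AE s in lborel. (R * exp (- R * (u - t))) * (indicator {..t} s * exp (- (R + r) * (t - s)))
      + R * (exp (- R * (u - s)) * exp (- r * (s - t)) * indicator {t..u} s)
      = indicator {..u} s * (R * exp (- R * (u - s))) * exp (- r * \<bar>t - s\<bar>)"
    using AE_lborel_singleton[of t]
  proof eventually_elim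
    case (elim s)
    then show ?case using True
      by (cases "s < t") (auto simp: indicator_def exp_add[symmetric] algebra_simps)
  qed
  ultimately have "has_bochner_integral lborel (\<lambda>s. indicator {..u} s * (R * exp (- R * (u - s))) * exp (- r * \<bar>t - s\<bar>))
     ((R * exp (- R * (u - t))) * (1 / (R + r)) + R * exp_quotient (u - t) R r)"
    by (subst (asm) has_bochner_integral_cong_AE) auto
  then show ?thesis using True by (simp add: mult.commute)
qed

section \<open>Averages of random variables\<close>

text \<open>
  Fubini's theorem for a family of random variables averaged with an integrable weight: a uniform
  bound on their first absolute moments makes \<open>K n * X n \<omega>\<close> integrable on the product space.
  It is used with \<open>P\<close> the underlying probability space and with \<open>P\<close> the mixing measure \<open>\<theta>\<close>.
\<close>

lemma weighted_average:
  fixes K :: "'n \<Rightarrow> real" and X :: "'n \<Rightarrow> 'o \<Rightarrow> real"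
  assumes "sigma_finite_measure N" "sigma_finite_measure P"
    and K: "integrable N K"
    and X [measurable]: "case_prod X \<in> borel_measurable (N \<Otimes>\<^sub>M P)"
    and X_int: "\<And>n. n \<in> space N \<Longrightarrow> integrable P (X n)"
    and X_bound: "\<And>n. n \<in> space N \<Longrightarrow> (\<integral>\<omega>. \<bar>X n \<omega>\<bar> \<partial>P) \<le> C"
  shows "integrable P (\<lambda>\<omega>. \<integral>n. K n * X n \<omega> \<partial>N)"
    and "(\<integral>\<omega>. (\<integral>n. K n * X n \<omega> \<partial>N) \<partial>P) = (\<integral>n. K n * (\<integral>\<omega>. X n \<omega> \<partial>P) \<partial>N)"
proof -
  interpret N: sigma_finite_measure N by fact
  interpret P: sigma_finite_measure P by fact
  interpret NP: pair_sigma_finite N P ..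
  have [measurable]: "K \<in> borel_measurable N" using K by auto
  have int: "integrable (N \<Otimes>\<^sub>M P) (\<lambda>(n, \<omega>). K n * X n \<omega>)"
  proof (rule NP.Fubini_integrable)
    show "integrable N (\<lambda>n. \<integral>\<omega>. norm (case (n, \<omega>) of (n, \<omega>) \<Rightarrow> K n * X n \<omega>) \<partial>P)"
    proof (rule Bochner_Integration.integrable_bound)
      show "integrable N (\<lambda>n. C * K n)" using K by simp
      show "AE n in N. norm (\<integral>\<omega>. norm (case (n, \<omega>) of (n, \<omega>) \<Rightarrow> K n * X n \<omega>) \<partial>P) \<le> norm (C * K n)"
      proof (rule AE_I2)
        fix n assume n: "n \<in> space N"
        have "0 \<le> (\<integral>\<omega>. \<bar>X n \<omega>\<bar> \<partial>P)" by simp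
        then have "\<bar>\<integral>\<omega>. \<bar>X n \<omega>\<bar> \<partial>P\<bar> \<le> \<bar>C\<bar>" using X_bound[OF n] by linarith
        then show "norm (\<integral>\<omega>. norm (case (n, \<omega>) of (n, \<omega>) \<Rightarrow> K n * X n \<omega>) \<partial>P) \<le> norm (C * K n)"
          by (simp add: abs_mult mult.commute[of _ "\<bar>K n\<bar>"] mult_left_mono)
      qed
    qed measurable
  qed (use X_int in auto)
  show "integrable P (\<lambda>\<omega>. \<integral>n. K n * X n \<omega> \<partial>N)"
    using NP.integrable_snd[OF int] by simp
  show "(\<integral>\<omega>. (\<integral>n. K n * X n \<omega> \<partial>N) \<partial>P) = (\<integral>n. K n * (\<integral>\<omega>. X n \<omega> \<partial>P) \<partial>N)"
    using NP.Fubini_integral[OF int] by simp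
qed

lemma abs_product_le_sum_squares: "\<bar>x * y\<bar> \<le> x\<^sup>2 + y\<^sup>2" for x y :: real
  using sum_squares_bound[of "\<bar>x\<bar>" "\<bar>y\<bar>"] abs_ge_zero[of "x * y"] unfolding abs_mult power2_abs by linarith

lemma integrable_product_of_square_integrable:
  fixes f g :: "'o \<Rightarrow> real"
  assumes [measurable]: "f \<in> borel_measurable M" "g \<in> borel_measurable M"
    and "integrable M (\<lambda>x. (f x)\<^sup>2)" "integrable M (\<lambda>x. (g x)\<^sup>2)"
  shows "integrable M (\<lambda>x. f x * g x)"
  by (rule Bochner_Integration.integrable_bound[OF Bochner_Integration.integrable_add[OF assms(3,4)]])
     (auto intro!: AE_I2 order_trans[OF abs_product_le_sum_squares])

section \<open>The weight of the past discharge\<close>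

text \<open>
  The weight with which the forcing at time \<open>s\<close> enters the part of the memory at time \<open>u\<close> that has
  reversion rate \<open>R\<close>. It takes a pair so that it is a function on \<open>\<rho> \<Otimes>\<^sub>M lborel\<close>.
\<close>

definition recency_weight :: "real \<Rightarrow> real \<times> real \<Rightarrow> real" where
  "recency_weight u = (\<lambda>(R, s). indicator {..u} s * (R * exp (- R * (u - s))))"

context memory_process
begin

sublocale \<rho>: prob_space \<rho> by (rule \<rho>_prob)
sublocale \<theta>: prob_space \<theta> by (rule \<theta>_prob)
sublocale \<rho>_time: pair_sigma_finite \<rho> lborel ..

lemma space_\<rho> [simp]: "space \<rho> = {0<..}"
  using sets_eq_imp_space_eq[OF \<rho>_sets] by (simp add: pos_borel_def space_restrict_space)

lemma space_\<theta> [simp]: "space \<theta> = {0<..}"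
  using sets_eq_imp_space_eq[OF \<theta>_sets] by (simp add: pos_borel_def space_restrict_space)

lemma ident_measurable_rates [measurable]:
  "(\<lambda>R. R) \<in> borel_measurable \<rho>" "(\<lambda>r. r) \<in> borel_measurable \<theta>"
  using measurable_restrict_space1[OF measurable_ident, of borel "{0<..}"]
  by (simp_all add: id_def measurable_cong_sets[OF \<rho>_sets refl] measurable_cong_sets[OF \<theta>_sets refl] pos_borel_def)

lemma recency_weight_measurable [measurable]:
  "recency_weight u \<in> borel_measurable (\<rho> \<Otimes>\<^sub>M lborel)"
proof -
  have [measurable]: "fst \<in> borel_measurable (\<rho> \<Otimes>\<^sub>M lborel)"
    using measurable_compose[OF measurable_fst ident_measurable_rates(1)] by simp
  show ?thesis unfolding recency_weight_def split_beta' by measurable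
qed

lemma recency_weight_normalised:
  assumes "0 < R"
  shows "has_bochner_integral lborel (\<lambda>s. recency_weight u (R, s)) 1"
proof -
  have "has_bochner_integral lborel (\<lambda>s. R * (indicator {..u} s * exp (- R * (u - s)))) (R * (1 / R))"
    using assms by (intro has_bochner_integral_mult_right has_bochner_integral_exp_half_line) auto
  then show ?thesis
    using assms by (simp add: recency_weight_def mult.left_commute)
qed

lemma recency_weight_nonneg: "0 < R \<Longrightarrow> 0 \<le> recency_weight u (R, s)"
  by (simp add: recency_weight_def)

lemma recency_weight_integrable: "integrable (\<rho> \<Otimes>\<^sub>M lborel) (recency_weight u)"
proof (rule \<rho>_time.Fubini_integrable)
  have "(\<integral>s. norm (recency_weight u (R, s)) \<partial>lborel) = 1" if "0 < R" for R
    using recency_weight_normalised[OF that, of u] recency_weight_nonneg[OF that]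
    by (simp add: has_bochner_integral_iff)
  then have "integrable \<rho> (\<lambda>R. \<integral>s. norm (recency_weight u (R, s)) \<partial>lborel) = integrable \<rho> (\<lambda>R. 1::real)"
    by (intro Bochner_Integration.integrable_cong) auto
  then show "integrable \<rho> (\<lambda>R. \<integral>s. norm (recency_weight u (R, s)) \<partial>lborel)" by simp
  show "AE R in \<rho>. integrable lborel (\<lambda>s. recency_weight u (R, s))"
    using recency_weight_normalised by (auto simp: has_bochner_integral_iff)
qed measurable

section \<open>Covariance with the drift and with the noise\<close>

lemma drift_part_eq_weighted_average:
  "drift_part \<rho> a b Q u {0<..} \<omega> =
    (\<integral>n. recency_weight u n * (a + b * Q (snd n) \<omega>) \<partial>(\<rho> \<Otimes>\<^sub>M lborel))"
  unfolding drift_part_def set_lebesgue_integral_def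
  by (intro Bochner_Integration.integral_cong)
     (auto simp: recency_weight_def space_pair_measure indicator_def)

lemma Q_measurable [measurable]: "Q t \<in> borel_measurable P"
  using Q_stationary by (simp add: stationary_process_def)

lemma Q_integrable [simp]: "integrable P (Q t)"
  using Q_square_integrable by (rule square_integrable_imp_integrable[rotated]) simp

lemma Q_second_moment: "expectation (\<lambda>\<omega>. (Q t \<omega>)\<^sup>2) = Vbar + Qbar\<^sup>2"
  using variance_eq[OF Q_integrable Q_square_integrable, of t] Q_variance[of t] by (simp add: Q_mean)

lemma Q_time_lift_measurable [measurable]:
  "(\<lambda>(n, \<omega>). Q (snd n) \<omega>) \<in> borel_measurable ((\<rho> \<Otimes>\<^sub>M lborel) \<Otimes>\<^sub>M P)"
proof -
  have "(\<lambda>x. (snd (fst x), snd x)) \<in> ((\<rho> \<Otimes>\<^sub>M lborel) \<Otimes>\<^sub>M P) \<rightarrow>\<^sub>M (borel \<Otimes>\<^sub>M P)"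
    by measurable
  from measurable_compose[OF this Q_jointly_measurable] show ?thesis
    by (simp add: split_beta')
qed

text \<open>
  The bound comes from \<open>\<bar>x y\<bar> \<le> x\<^sup>2 + y\<^sup>2\<close>; what matters is that it does not depend on \<open>s\<close>, so that
  the product may be averaged over \<open>s\<close>. The covariance contains no \<open>a\<close> because \<open>Q t - Qbar\<close> is
  centred.
\<close>

lemma deviation_times_forcing:
  shows "integrable P (\<lambda>\<omega>. (Q t \<omega> - Qbar) * (a + b * Q s \<omega>))"
    and "expectation (\<lambda>\<omega>. \<bar>(Q t \<omega> - Qbar) * (a + b * Q s \<omega>)\<bar>)
      \<le> Vbar + (2 * a\<^sup>2 + 2 * b\<^sup>2 * (Vbar + Qbar\<^sup>2))"
    and "expectation (\<lambda>\<omega>. (Q t \<omega> - Qbar) * (a + b * Q s \<omega>)) =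
      b * Vbar * autocorrelation \<theta> \<bar>t - s\<bar>"
proof -
  let ?g = "\<lambda>\<omega>. (Q t \<omega> - Qbar)\<^sup>2 + (2 * a\<^sup>2 + 2 * b\<^sup>2 * (Q s \<omega>)\<^sup>2)"
  have dev_sq: "integrable P (\<lambda>\<omega>. (Q x \<omega> - Qbar)\<^sup>2)" for x
    using Q_square_integrable by (simp add: power2_diff)
  have g_int: "integrable P ?g" using dev_sq Q_square_integrable by simp
  have le: "\<bar>(Q t \<omega> - Qbar) * (a + b * Q s \<omega>)\<bar> \<le> ?g \<omega>" for \<omega>
  proof -
    have "(a + b * Q s \<omega>)\<^sup>2 \<le> 2 * a\<^sup>2 + 2 * b\<^sup>2 * (Q s \<omega>)\<^sup>2"
      using sum_squares_bound[of a "b * Q s \<omega>"] by (simp add: power2_sum power_mult_distrib)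
    then show ?thesis using abs_product_le_sum_squares[of "Q t \<omega> - Qbar" "a + b * Q s \<omega>"] by linarith
  qed
  show int: "integrable P (\<lambda>\<omega>. (Q t \<omega> - Qbar) * (a + b * Q s \<omega>))"
    using g_int by (rule Bochner_Integration.integrable_bound) (use le in \<open>auto intro!: AE_I2 order_trans[OF le]\<close>)
  have "expectation (\<lambda>\<omega>. \<bar>(Q t \<omega> - Qbar) * (a + b * Q s \<omega>)\<bar>) \<le> expectation ?g"
    using int g_int le by (intro integral_mono) auto
  also have "\<dots> = Vbar + (2 * a\<^sup>2 + 2 * b\<^sup>2 * (Vbar + Qbar\<^sup>2))"
    using dev_sq[of t] Q_square_integrable Q_variance[of t] by (simp add: Q_second_moment Q_mean prob_space)
  finally show "expectation (\<lambda>\<omega>. \<bar>(Q t \<omega> - Qbar) * (a + b * Q s \<omega>)\<bar>) \<le> \<dots>" .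
  have split: "(Q t \<omega> - Qbar) * (a + b * Q s \<omega>) =
      b * ((Q t \<omega> - Qbar) * (Q s \<omega> - Qbar)) + (a + b * Qbar) * (Q t \<omega> - Qbar)" for \<omega>
    by (simp add: algebra_simps)
  have "integrable P (\<lambda>\<omega>. (Q t \<omega> - Qbar) * (Q s \<omega> - Qbar))"
    using dev_sq by (intro integrable_product_of_square_integrable) auto
  then show "expectation (\<lambda>\<omega>. (Q t \<omega> - Qbar) * (a + b * Q s \<omega>)) =
      b * Vbar * autocorrelation \<theta> \<bar>t - s\<bar>"
    using Q_autocovariance[of t s] unfolding split
    by (simp add: covariance_def Q_mean prob_space)
qed

text \<open>
  The factor \<open>Q t - Qbar\<close> does not depend on the averaging variables, so it can be moved into the
  average, and the expectation follows it by Fubini's theorem.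
\<close>

lemma drift_part_moments:
  fixes t u :: real
  defines "D \<equiv> drift_part \<rho> a b Q u {0<..}"
  shows "integrable P D"
    and "integrable P (\<lambda>\<omega>. (Q t \<omega> - Qbar) * D \<omega>)"
    and "expectation (\<lambda>\<omega>. (Q t \<omega> - Qbar) * D \<omega>) =
      b * Vbar * (\<integral>n. recency_weight u n * autocorrelation \<theta> \<bar>t - snd n\<bar> \<partial>(\<rho> \<Otimes>\<^sub>M lborel))"
proof -
  have meas [measurable]:
      "(\<lambda>(n, \<omega>). a + b * Q (snd n) \<omega>) \<in> borel_measurable ((\<rho> \<Otimes>\<^sub>M lborel) \<Otimes>\<^sub>M P)"
    using Q_time_lift_measurable unfolding split_beta' by simp
  have "expectation (\<lambda>\<omega>. \<bar>a + b * Q s \<omega>\<bar>) = a + b * Qbar" for s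
  proof -
    have "expectation (\<lambda>\<omega>. \<bar>a + b * Q s \<omega>\<bar>) = expectation (\<lambda>\<omega>. a + b * Q s \<omega>)"
      using a_nonneg b_nonneg Q_nonneg by (intro Bochner_Integration.integral_cong) auto
    then show ?thesis by (simp add: Q_mean prob_space)
  qed
  then show "integrable P D"
    unfolding D_def drift_part_eq_weighted_average
    by (intro weighted_average(1)[OF _ _ recency_weight_integrable meas, where C="a + b * Qbar"])
       (simp_all add: sigma_finite_measure_axioms \<rho>_time.sigma_finite_measure_axioms)
  have meas': "(\<lambda>(n, \<omega>). (Q t \<omega> - Qbar) * (a + b * Q (snd n) \<omega>))
      \<in> borel_measurable ((\<rho> \<Otimes>\<^sub>M lborel) \<Otimes>\<^sub>M P)"
    using meas unfolding split_beta' by measurable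
  note avg = weighted_average[OF _ _ recency_weight_integrable[of u] meas', OF
    \<rho>_time.sigma_finite_measure_axioms sigma_finite_measure_axioms
    deviation_times_forcing(1) deviation_times_forcing(2)]
  have pull: "(Q t \<omega> - Qbar) * D \<omega> = (\<integral>n. recency_weight u n *
      ((Q t \<omega> - Qbar) * (a + b * Q (snd n) \<omega>)) \<partial>(\<rho> \<Otimes>\<^sub>M lborel))" for \<omega>
    unfolding D_def drift_part_eq_weighted_average integral_mult_right_zero[symmetric]
    by (simp add: mult.left_commute)
  show "integrable P (\<lambda>\<omega>. (Q t \<omega> - Qbar) * D \<omega>)"
    unfolding pull by (rule avg(1))
  show "expectation (\<lambda>\<omega>. (Q t \<omega> - Qbar) * D \<omega>) =
      b * Vbar * (\<integral>n. recency_weight u n * autocorrelation \<theta> \<bar>t - snd n\<bar> \<partial>(\<rho> \<Otimes>\<^sub>M lborel))"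
    unfolding pull avg(2) deviation_times_forcing(3) integral_mult_right_zero[symmetric]
    by (simp add: mult_ac)
qed

text \<open>
  The autocorrelation is bounded by one, so it is integrable against the weight and the average can
  be evaluated as an iterated integral. For each fixed \<open>R\<close> the mixing measure \<open>\<theta>\<close> is then moved
  outside the time integral.
\<close>

lemma weighted_autocorrelation:
  "(\<integral>n. recency_weight u n * autocorrelation \<theta> \<bar>t - snd n\<bar> \<partial>(\<rho> \<Otimes>\<^sub>M lborel)) =
    (\<integral>R. (\<integral>r. (if t \<le> u then R / (R + r) * exp (- R * (u - t)) + R * exp_quotient (u - t) R r
     else R / (R + r) * exp (- r * (t - u))) \<partial>\<theta>) \<partial>\<rho>)"
proof -
  have decay_meas: "(\<lambda>(s, r). exp (- r * \<bar>t - s\<bar>)) \<in> borel_measurable (lborel \<Otimes>\<^sub>M \<theta>)"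
    unfolding split_beta'
  proof -
    have [measurable]: "snd \<in> borel_measurable (lborel \<Otimes>\<^sub>M \<theta>)"
      using measurable_compose[OF measurable_snd ident_measurable_rates(2)] by simp
    show "(\<lambda>x. exp (- snd x * \<bar>t - fst x\<bar>)) \<in> borel_measurable (lborel \<Otimes>\<^sub>M \<theta>)"
      by measurable
  qed
  have decay_int: "integrable \<theta> (\<lambda>r. exp (- r * \<bar>t - s\<bar>))" for s
    by (rule \<theta>.integrable_const_bound[where B=1]) (auto intro!: AE_I2)
  have decay_bound: "(\<integral>r. \<bar>exp (- r * \<bar>t - s\<bar>)\<bar> \<partial>\<theta>) \<le> 1" for s
    using decay_int by (intro \<theta>.integral_le_const) (auto intro!: AE_I2)
  have auto_meas [measurable]: "(\<lambda>s. autocorrelation \<theta> \<bar>t - s\<bar>) \<in> borel_measurable borel"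
    using \<theta>.borel_measurable_lebesgue_integral[OF decay_meas]
    by (simp add: autocorrelation_def)
  have auto_bound: "\<bar>autocorrelation \<theta> \<bar>t - s\<bar>\<bar> \<le> 1" for s
    unfolding autocorrelation_def
    by (rule order_trans[OF integral_abs_bound decay_bound])
  have "integrable (\<rho> \<Otimes>\<^sub>M lborel) (\<lambda>n. recency_weight u n * autocorrelation \<theta> \<bar>t - snd n\<bar>)"
    using recency_weight_integrable[of u]
    by (rule Bochner_Integration.integrable_bound)
       (auto intro!: AE_I2 mult_left_le simp: abs_mult auto_bound)
  from \<rho>_time.integral_fst'[OF this, symmetric]
  have "(\<integral>n. recency_weight u n * autocorrelation \<theta> \<bar>t - snd n\<bar> \<partial>(\<rho> \<Otimes>\<^sub>M lborel)) =
      (\<integral>R. (\<integral>s. recency_weight u (R, s) * autocorrelation \<theta> \<bar>t - s\<bar> \<partial>lborel) \<partial>\<rho>)"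
    by simp
  also have "\<dots> = (\<integral>R. (\<integral>r. (\<integral>s. recency_weight u (R, s) * exp (- r * \<bar>t - s\<bar>) \<partial>lborel) \<partial>\<theta>) \<partial>\<rho>)"
  proof (rule Bochner_Integration.integral_cong[OF refl])
    fix R assume "R \<in> space \<rho>"
    then have "integrable lborel (\<lambda>s. recency_weight u (R, s))"
      using recency_weight_normalised by (simp add: has_bochner_integral_iff)
    from weighted_average(2)[OF lborel.sigma_finite_measure_axioms \<theta>.sigma_finite_measure_axioms this
        decay_meas decay_int decay_bound]
    show "(\<integral>s. recency_weight u (R, s) * autocorrelation \<theta> \<bar>t - s\<bar> \<partial>lborel) =
        (\<integral>r. (\<integral>s. recency_weight u (R, s) * exp (- r * \<bar>t - s\<bar>) \<partial>lborel) \<partial>\<theta>)"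
      by (simp add: autocorrelation_def)
  qed
  also have "\<dots> = (\<integral>R. (\<integral>r. (if t \<le> u then R / (R + r) * exp (- R * (u - t)) + R * exp_quotient (u - t) R r
     else R / (R + r) * exp (- r * (t - u))) \<partial>\<theta>) \<partial>\<rho>)"
    unfolding recency_weight_def case_prod_conv
    by (intro Bochner_Integration.integral_cong refl has_bochner_integral_integral_eq lag_integral) simp_all
  finally show ?thesis .
qed

lemma Q_measurable_generated: "Q t \<in> borel_measurable (generated_algebra P Q)"
proof (rule measurableI)
  fix A :: "real set" assume "A \<in> sets borel"
  then have "Q t -` A \<inter> space P \<in> {Q t -` A \<inter> space P | t A. A \<in> sets borel}" by blast
  then show "Q t -` A \<inter> space (generated_algebra P Q) \<in> sets (generated_algebra P Q)"
    unfolding generated_algebra_def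
    by (subst sets_measure_of, blast, subst space_measure_of, blast, rule sigma_sets.Basic)
qed auto

lemma noise_part_moments:
  assumes f: "noise_integrable P m f"
  shows "integrable P (BI f)"
    and "integrable P (\<lambda>\<omega>. (Q t \<omega> - Qbar) * BI f \<omega>)"
    and "expectation (\<lambda>\<omega>. (Q t \<omega> - Qbar) * BI f \<omega>) = 0"
proof -
  note [measurable] = BI_measurable[OF f]
  show "integrable P (BI f)"
    using BI_square_integrable[OF f] by (rule square_integrable_imp_integrable[rotated]) simp
  show "integrable P (\<lambda>\<omega>. (Q t \<omega> - Qbar) * BI f \<omega>)"
    using BI_square_integrable[OF f] Q_square_integrable
    by (intro integrable_product_of_square_integrable) (auto simp: power2_diff)
  show "expectation (\<lambda>\<omega>. (Q t \<omega> - Qbar) * BI f \<omega>) = 0"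
    using BI_uncorrelated[OF f Q_measurable_generated Q_square_integrable, of t]
    by (simp add: covariance_def BI_mean_zero[OF f] Q_mean mult.commute)
qed

end

section \<open>The total memory\<close>

lemma measurable_emeasure_measure_algebra:
  "A \<in> sets K \<Longrightarrow> (\<lambda>\<mu>. emeasure \<mu> A) \<in> borel_measurable (measure_algebra K)"
  by (auto intro!: measurable_Sup1 measurable_vimage_algebra1 simp: measure_algebra_def)

context memory_process
begin

lemma total_memory_decomposition:
  "AE \<omega> in P. total_memory m u \<omega> =
    drift_part \<rho> a b Q u {0<..} \<omega> + BI (noise_kernel \<sigma> u {0<..}) \<omega>"
proof -
  have "{0<..} \<in> sets pos_borel" by (simp add: pos_borel_def sets_restrict_space_iff)
  from integrated_equation[OF this, of u] show ?thesis
    by eventually_elim (simp add: total_memory_def measure_def enn2real_def)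
qed

text \<open>
  The decomposition holds only almost surely, so measurability is taken from the measure-valued
  process itself.
\<close>

lemma total_memory_measurable [measurable]: "total_memory m u \<in> borel_measurable P"
proof -
  have "m u \<in> P \<rightarrow>\<^sub>M measure_algebra pos_borel"
    using m_stationary by (simp add: stationary_process_def)
  moreover have "{0<..} \<in> sets pos_borel" by (simp add: pos_borel_def sets_restrict_space_iff)
  ultimately have "(\<lambda>\<omega>. emeasure (m u \<omega>) {0<..}) \<in> borel_measurable P"
    using measurable_compose measurable_emeasure_measure_algebra by blast
  then show ?thesis unfolding total_memory_def measure_def by measurable
qed

lemma covariance_total_memory:
  shows "integrable P (total_memory m u)"
    and "integrable P (\<lambda>\<omega>. (Q t \<omega> - Qbar) * (total_memory m u \<omega> - expectation (total_memory m u)))"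
    and "covariance P (Q t) (total_memory m u) =
      (if t \<le> u then F_cov b Vbar \<rho> \<theta> (u - t) else G_cov b Vbar \<rho> \<theta> (t - u))"
proof -
  let ?D = "drift_part \<rho> a b Q u {0<..}" and ?N = "BI (noise_kernel \<sigma> u {0<..})"
  let ?M = "total_memory m u"
  have f: "noise_integrable P m (noise_kernel \<sigma> u {0<..})"
    by (rule noise_kernel_integrable) (simp add: pos_borel_def sets_restrict_space_iff)
  note [simp] = drift_part_moments[where u=u] noise_part_moments[OF f]
  have [measurable]: "?D \<in> borel_measurable P"
    by (rule borel_measurable_integrable) simp
  note [measurable] = BI_measurable[OF f]
  have "integrable P ?M \<longleftrightarrow> integrable P (\<lambda>\<omega>. ?D \<omega> + ?N \<omega>)"
    using total_memory_decomposition by (intro integrable_cong_AE) auto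
  then show "integrable P ?M" by simp
  have product: "AE \<omega> in P. (Q t \<omega> - Qbar) * ?M \<omega> = (Q t \<omega> - Qbar) * ?D \<omega> + (Q t \<omega> - Qbar) * ?N \<omega>"
    using total_memory_decomposition[of u] by eventually_elim (simp add: algebra_simps)
  have "integrable P (\<lambda>\<omega>. (Q t \<omega> - Qbar) * ?M \<omega>) \<longleftrightarrow>
      integrable P (\<lambda>\<omega>. (Q t \<omega> - Qbar) * ?D \<omega> + (Q t \<omega> - Qbar) * ?N \<omega>)"
    using product by (intro integrable_cong_AE) auto
  then have int: "integrable P (\<lambda>\<omega>. (Q t \<omega> - Qbar) * ?M \<omega>)" by simp
  \<comment> \<open>Since \<open>Q t - Qbar\<close> has mean zero, subtracting a constant from \<open>M\<close> leaves the expectation of the product unchanged.\<close>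
  have centre: "(Q t \<omega> - Qbar) * (?M \<omega> - c) = (Q t \<omega> - Qbar) * ?M \<omega> - c * (Q t \<omega> - Qbar)" for \<omega> c
    by (simp add: algebra_simps)
  show "integrable P (\<lambda>\<omega>. (Q t \<omega> - Qbar) * (?M \<omega> - expectation ?M))"
    unfolding centre using int by simp
  have "covariance P (Q t) ?M = expectation (\<lambda>\<omega>. (Q t \<omega> - Qbar) * ?M \<omega>)"
    unfolding covariance_def Q_mean centre using int by (simp add: Q_mean prob_space)
  also have "\<dots> = expectation (\<lambda>\<omega>. (Q t \<omega> - Qbar) * ?D \<omega> + (Q t \<omega> - Qbar) * ?N \<omega>)"
    using product by (intro integral_cong_AE) auto
  also have "\<dots> = b * Vbar * (\<integral>n. recency_weight u n * autocorrelation \<theta> \<bar>t - snd n\<bar> \<partial>(\<rho> \<Otimes>\<^sub>M lborel))"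
    by simp
  finally show "covariance P (Q t) ?M =
      (if t \<le> u then F_cov b Vbar \<rho> \<theta> (u - t) else G_cov b Vbar \<rho> \<theta> (t - u))"
    by (simp add: weighted_autocorrelation F_cov_def G_cov_def)
qed

end

theorem proposition3:
  fixes P :: "'a measure" and Filt :: "real \<Rightarrow> 'a measure"
    and Q :: "real \<Rightarrow> 'a \<Rightarrow> real" and Qbar Vbar :: real and \<theta> :: "real measure"
    and m :: "real \<Rightarrow> 'a \<Rightarrow> real measure" and BI :: "(real \<Rightarrow> real \<Rightarrow> real) \<Rightarrow> 'a \<Rightarrow> real"
    and a b \<sigma> :: real and \<rho> :: "real measure"
  assumes model: "memory_process P Filt Q Qbar Vbar \<theta> m BI a b \<sigma> \<rho>"
    and rho_first_moment: "integrable \<rho> (\<lambda>R. R)"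
  shows "(\<forall>t. integrable P (total_memory m t)) \<and>
    (\<forall>t h. integrable P (\<lambda>\<omega>. (Q t \<omega> - integral\<^sup>L P (Q t)) *
        (total_memory m (t + h) \<omega> - integral\<^sup>L P (total_memory m (t + h))))) \<and>
    (\<forall>t h. mutual_covariance P Q (total_memory m) t h =
        (if 0 \<le> h then F_cov b Vbar \<rho> \<theta> h else G_cov b Vbar \<rho> \<theta> (- h))) \<and>
    (\<forall>t. covariance P (Q t) (total_memory m t) = mutual_covariance P Q (total_memory m) t 0 \<and>
        mutual_covariance P Q (total_memory m) t 0 =
          b * Vbar * (\<integral>R. (\<integral>r. R / (R + r) \<partial>\<theta>) \<partial>\<rho>))"
proof -
  interpret memory_process P Filt Q Qbar Vbar \<theta> m BI a b \<sigma> \<rho> by (rule model)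
  have cov: "mutual_covariance P Q (total_memory m) t h =
      (if 0 \<le> h then F_cov b Vbar \<rho> \<theta> h else G_cov b Vbar \<rho> \<theta> (- h))" for t h
    by (simp add: mutual_covariance_def covariance_total_memory(3))
  \<comment> \<open>At lag zero the second summand in the integrand of \<open>F\<close> vanishes, on the diagonal as well.\<close>
  have "exp_quotient 0 R r = 0" for R r by (simp add: exp_quotient_def)
  then have "F_cov b Vbar \<rho> \<theta> 0 = b * Vbar * (\<integral>R. (\<integral>r. R / (R + r) \<partial>\<theta>) \<partial>\<rho>)"
    by (simp add: F_cov_def)
  then show ?thesis
    using covariance_total_memory covariance_total_memory(3)[of t t for t]
    by (simp add: cov Q_mean)
qed

end
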